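(* Let $a>0$ and $b\in\mathbb{R}$ be constants and let $\mathbb{R}^3_+=\{(x,y,z)\in\mathbb{R}^3 : y>0\}$. Then the map $$\pi:\Big(\mathbb{R}^3_+,\ \frac{a^2(dx^2+dy^2)}{y^2}+\Big(dz+\frac{ba}{y}\,dx\Big)^2\Big)\to\Big(\{(y,z)\in\mathbb{R}^2: y>0\},\ \frac{a^2dy^2}{y^2}+\frac{dz^2}{1+b^2}\Big),\qquad \pi(x,y,z)=(y,z),$$ is a Riemannian submersion which is a proper biharmonic map.
   Context: For a smooth map $\varphi:(M,g)\to(N,h)$ between Riemannian manifolds, the tension field is $\tau(\varphi)=\mathrm{Trace}_g\nabla d\varphi$; $\varphi$ is harmonic if $\tau(\varphi)=0$. The map $\varphi$ is biharmonic if its bitension field vanishes: $$\tau^2(\varphi)=\mathrm{Trace}_g\big(\nabla^{\varphi}\nabla^{\varphi}-\nabla^{\varphi}_{\nabla^{M}}\big)\tau(\varphi)-\mathrm{Trace}_g R^N(d\varphi,\tau(\varphi))d\varphi=0,$$ where $R^N(X,Y)Z=[\nabla^N_X,\nabla^N_Y]Z-\nabla^N_{[X,Y]}Z$. A proper biharmonic map is a biharmonic map that is not harmonic. *)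

theory Defs
  imports "HOL-Analysis.Analysis"
begin

text \<open>
  Riemannian manifolds are rendered here as open subsets of \<open>real ^ 'n\<close> carrying a Riemannian metric,
  with the identity as a global chart.  Tangent vectors at every point are elements of
  \<open>real ^ 'n\<close>, vector fields are functions \<open>real ^ 'n \<Rightarrow> real ^ 'n\<close>, and sections along a map
  \<open>\<phi>\<close> (i.e. of the pull-back of the tangent bundle of the target) are functions from the source
  to \<open>real ^ 'm\<close>.  All functions are total; only their values on the open set matter.
\<close>

section \<open>Smoothness\<close>

primrec Ck_on :: "nat \<Rightarrow> 'a::euclidean_space set \<Rightarrow> ('a \<Rightarrow> 'b::real_normed_vector) \<Rightarrow> bool" where
  "Ck_on 0 U f \<longleftrightarrow> continuous_on U f"
| "Ck_on (Suc k) U f \<longleftrightarrow>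
     f differentiable_on U \<and> (\<forall>v. Ck_on k U (\<lambda>x. frechet_derivative f (at x) v))"

definition smooth_on :: "'a::euclidean_space set \<Rightarrow> ('a \<Rightarrow> 'b::real_normed_vector) \<Rightarrow> bool" where
  "smooth_on U f \<longleftrightarrow> (\<forall>k. Ck_on k U f)"

section \<open>Riemannian metrics\<close>

type_synonym 'n tensor2 = "real ^ 'n \<Rightarrow> real ^ 'n \<Rightarrow> real ^ 'n \<Rightarrow> real"
type_synonym 'n vfield = "real ^ 'n \<Rightarrow> real ^ 'n"

definition riemannian_metric_on :: "(real ^ 'n::finite) set \<Rightarrow> 'n tensor2 \<Rightarrow> bool" where
  "riemannian_metric_on U g \<longleftrightarrow>
     open U \<and>
     (\<forall>p\<in>U. bilinear (g p) \<and> (\<forall>u v. g p u v = g p v u) \<and> (\<forall>v. v \<noteq> 0 \<longrightarrow> g p v v > 0)) \<and>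
     (\<forall>u v. smooth_on U (\<lambda>p. g p u v))"

definition metric_matrix :: "'n::finite tensor2 \<Rightarrow> real ^ 'n \<Rightarrow> real ^ 'n ^ 'n" where
  "metric_matrix g p = (\<chi> i j. g p (axis i 1) (axis j 1))"

definition metric_inverse :: "'n::finite tensor2 \<Rightarrow> real ^ 'n \<Rightarrow> real ^ 'n ^ 'n" where
  "metric_inverse g p = matrix_inv (metric_matrix g p)"

definition metric_trace ::
  "'n::finite tensor2 \<Rightarrow> real ^ 'n \<Rightarrow> (real ^ 'n \<Rightarrow> real ^ 'n \<Rightarrow> 'b::real_vector) \<Rightarrow> 'b" where
  "metric_trace g p B = (\<Sum>i\<in>UNIV. \<Sum>j\<in>UNIV. (metric_inverse g p $ i $ j) *\<^sub>R B (axis i 1) (axis j 1))"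

section \<open>The Levi-Civita connection and its curvature\<close>

text \<open>\<open>metric_deriv g p w u v\<close> is the derivative at \<open>p\<close> in direction \<open>w\<close> of \<open>g(u,v)\<close>,
  with \<open>u\<close>, \<open>v\<close> extended as constant fields.\<close>

definition metric_deriv ::
  "'n::finite tensor2 \<Rightarrow> real ^ 'n \<Rightarrow> real ^ 'n \<Rightarrow> real ^ 'n \<Rightarrow> real ^ 'n \<Rightarrow> real" where
  "metric_deriv g p w u v = frechet_derivative (\<lambda>q. g q u v) (at p) w"

text \<open>\<open>christoffel_symbol g p k i j\<close> is \<open>\<Gamma>\<^sup>k\<^sub>i\<^sub>j\<close>
  at \<open>p\<close>, and \<open>christoffel g p u v\<close> is the vector with \<open>k\<close>-th component
  \<open>\<Gamma>\<^sup>k\<^sub>i\<^sub>j u\<^sup>i v\<^sup>j\<close>.\<close>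

definition christoffel_symbol :: "'n::finite tensor2 \<Rightarrow> real ^ 'n \<Rightarrow> 'n \<Rightarrow> 'n \<Rightarrow> 'n \<Rightarrow> real" where
  "christoffel_symbol g p k i j =
     (1/2) * (\<Sum>l\<in>UNIV. (metric_inverse g p $ k $ l) *
       (metric_deriv g p (axis i 1) (axis j 1) (axis l 1)
        + metric_deriv g p (axis j 1) (axis i 1) (axis l 1)
        - metric_deriv g p (axis l 1) (axis i 1) (axis j 1)))"

definition christoffel :: "'n::finite tensor2 \<Rightarrow> real ^ 'n \<Rightarrow> real ^ 'n \<Rightarrow> real ^ 'n \<Rightarrow> real ^ 'n" where
  "christoffel g p u v =
     (\<chi> k. \<Sum>i\<in>UNIV. \<Sum>j\<in>UNIV. christoffel_symbol g p k i j * u $ i * v $ j)"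

definition levi_civita :: "'n::finite tensor2 \<Rightarrow> 'n vfield \<Rightarrow> 'n vfield \<Rightarrow> 'n vfield" where
  "levi_civita g X Y p = frechet_derivative Y (at p) (X p) + christoffel g p (X p) (Y p)"

definition lie_bracket :: "'n::finite vfield \<Rightarrow> 'n vfield \<Rightarrow> 'n vfield" where
  "lie_bracket X Y p = frechet_derivative Y (at p) (X p) - frechet_derivative X (at p) (Y p)"

definition curvature ::
  "'n::finite tensor2 \<Rightarrow> 'n vfield \<Rightarrow> 'n vfield \<Rightarrow> 'n vfield \<Rightarrow> 'n vfield" where
  "curvature g X Y Z p =
     levi_civita g X (levi_civita g Y Z) p - levi_civita g Y (levi_civita g X Z) p
     - levi_civita g (lie_bracket X Y) Z p"

text \<open>The curvature is tensorial, so its value on tangent vectors at \<open>p\<close> may be computed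
  from their extensions to constant vector fields.\<close>

definition curvature_at ::
  "'n::finite tensor2 \<Rightarrow> real ^ 'n \<Rightarrow> real ^ 'n \<Rightarrow> real ^ 'n \<Rightarrow> real ^ 'n \<Rightarrow> real ^ 'n" where
  "curvature_at g p u v w = curvature g (\<lambda>_. u) (\<lambda>_. v) (\<lambda>_. w) p"

subsection \<open>Koszul formula, torsion-freeness and metric compatibility\<close>

text \<open>These facts identify \<open>levi_civita\<close> as the Levi-Civita connection.\<close>

context
  fixes U :: "(real ^ 'n::finite) set" and g :: "'n tensor2"
  assumes g: "riemannian_metric_on U g"
begin

lemma metric_bilinear: "p \<in> U \<Longrightarrow> bilinear (g p)"
  and metric_sym: "p \<in> U \<Longrightarrow> g p u v = g p v u"
  and metric_pos: "p \<in> U \<Longrightarrow> v \<noteq> 0 \<Longrightarrow> g p v v > 0"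
  and metric_open: "open U"
  using g by (simp_all add: riemannian_metric_on_def)

lemma metric_differentiable:
  assumes "p \<in> U" shows "(\<lambda>q. g q u v) differentiable (at p)"
proof -
  have "smooth_on U (\<lambda>p. g p u v)" using g unfolding riemannian_metric_on_def by blast
  then have "Ck_on (Suc 0) U (\<lambda>p. g p u v)" unfolding smooth_on_def by blast
  then have "(\<lambda>p. g p u v) differentiable_on U" by (simp only: Ck_on.simps)
  then show ?thesis
    using differentiable_on_eq_differentiable_at[OF metric_open] assms by blast
qed

lemma metric_expand:
  assumes "p \<in> U"
  shows "g p u v = (\<Sum>i\<in>UNIV. \<Sum>j\<in>UNIV. u $ i * v $ j * g p (axis i 1) (axis j 1))"
proof -
  have bl: "bilinear (g p)" using metric_bilinear assms .
  have "g p u v = g p (\<Sum>i\<in>UNIV. u $ i *s axis i 1) (\<Sum>j\<in>UNIV. v $ j *s axis j 1)"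
    by (simp add: basis_expansion)
  also have "\<dots> = (\<Sum>(i,j)\<in>UNIV \<times> UNIV. g p (u $ i *s axis i 1) (v $ j *s axis j 1))"
    using bilinear_sum[OF bl] by blast
  also have "\<dots> = (\<Sum>i\<in>UNIV. \<Sum>j\<in>UNIV. u $ i * v $ j * g p (axis i 1) (axis j 1))"
    by (simp only: sum.cartesian_product[symmetric])
       (simp add: scalar_mult_eq_scaleR bilinear_lmul[OF bl] bilinear_rmul[OF bl] algebra_simps)
  finally show ?thesis .
qed

lemma metric_inverse_left:
  assumes "p \<in> U" shows "metric_inverse g p ** metric_matrix g p = mat 1"
proof -
  let ?G = "metric_matrix g p"
  have "x = 0" if "?G *v x = 0" for x
  proof (rule ccontr)
    assume "x \<noteq> 0"
    have "g p x x = (\<Sum>i\<in>UNIV. x $ i * (?G *v x) $ i)"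
      unfolding metric_expand[OF assms, of x x] matrix_vector_mult_def metric_matrix_def
      by (simp add: sum_distrib_left algebra_simps)
    then show False using that metric_pos[OF assms \<open>x \<noteq> 0\<close>] by simp
  qed
  then have "\<exists>B. B ** ?G = mat 1" using matrix_left_invertible_ker by blast
  then have "invertible ?G" by (simp add: invertible_left_inverse)
  then have "\<exists>A'. ?G ** A' = mat 1 \<and> A' ** ?G = mat 1" by (simp add: invertible_def)
  from someI_ex[OF this] show ?thesis
    unfolding metric_inverse_def matrix_inv_def by blast
qed

lemma metric_inverse_sym:
  assumes "p \<in> U" shows "metric_inverse g p $ i $ j = metric_inverse g p $ j $ i"
proof -
  let ?G = "metric_matrix g p" and ?H = "metric_inverse g p"
  have t: "transpose ?G = ?G"
    using metric_sym[OF assms] by (simp add: transpose_def metric_matrix_def vec_eq_iff)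
  have 1: "?H ** ?G = mat 1" using metric_inverse_left[OF assms] .
  then have 2: "?G ** ?H = mat 1" using matrix_left_right_inverse by blast
  have "transpose ?H ** ?G = mat 1"
    by (metis 2 t matrix_transpose_mul transpose_mat)
  then have "transpose ?H = ?H" using 2
    by (metis matrix_mul_assoc matrix_mul_lid matrix_mul_rid)
  then have "transpose ?H $ i $ j = ?H $ i $ j" by simp
  then show ?thesis by (simp add: transpose_def)
qed

lemma has_derivative_metric:
  assumes p: "p \<in> U"
    and Y: "(Y has_derivative Y') (at p)" and Z: "(Z has_derivative Z') (at p)"
  shows "((\<lambda>q. g q (Y q) (Z q)) has_derivative
      (\<lambda>w. metric_deriv g p w (Y p) (Z p) + g p (Y' w) (Z p) + g p (Y p) (Z' w))) (at p)"
    and "metric_deriv g p w u v =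
      (\<Sum>i\<in>UNIV. \<Sum>j\<in>UNIV. u $ i * v $ j * metric_deriv g p w (axis i 1) (axis j 1))"
proof -
  have D: "((\<lambda>q. g q u v) has_derivative (\<lambda>w. metric_deriv g p w u v)) (at p)" for u v
    using metric_differentiable[OF p, of u v] frechet_derivative_works
    unfolding metric_deriv_def by blast
  have comp: "((\<lambda>q. F q $ i) has_derivative (\<lambda>w. F' w $ i)) (at p)"
    if "(F has_derivative F') (at p)" for F :: "real ^ 'n \<Rightarrow> real ^ 'n" and F' i
    using bounded_linear.has_derivative[OF bounded_linear_vec_nth that] .
  have E: "((\<lambda>q. \<Sum>i\<in>UNIV. \<Sum>j\<in>UNIV. F q $ i * H q $ j * g q (axis i 1) (axis j 1)) has_derivative
     (\<lambda>w. \<Sum>i\<in>UNIV. \<Sum>j\<in>UNIV. (F p $ i * H p $ j * metric_deriv g p w (axis i 1) (axis j 1)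
        + (F p $ i * H' w $ j + F' w $ i * H p $ j) * g p (axis i 1) (axis j 1)))) (at p)"
    if "(F has_derivative F') (at p)" "(H has_derivative H') (at p)" for F H F' H'
    by (intro has_derivative_sum has_derivative_mult comp that D)
  have T: "((\<lambda>q. g q (F q) (H q)) has_derivative
     (\<lambda>w. \<Sum>i\<in>UNIV. \<Sum>j\<in>UNIV. (F p $ i * H p $ j * metric_deriv g p w (axis i 1) (axis j 1)
        + (F p $ i * H' w $ j + F' w $ i * H p $ j) * g p (axis i 1) (axis j 1)))) (at p)"
    if "(F has_derivative F') (at p)" "(H has_derivative H') (at p)" for F H F' H'
    by (rule has_derivative_transform_within_open[OF E[OF that] metric_open p])
       (rule metric_expand[symmetric])
  have md: "metric_deriv g p w u v =
      (\<Sum>i\<in>UNIV. \<Sum>j\<in>UNIV. u $ i * v $ j * metric_deriv g p w (axis i 1) (axis j 1))" for w u v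
    using fun_cong[OF has_derivative_unique[OF D T[OF has_derivative_const has_derivative_const]], of w u v]
    by simp
  then show "metric_deriv g p w u v =
      (\<Sum>i\<in>UNIV. \<Sum>j\<in>UNIV. u $ i * v $ j * metric_deriv g p w (axis i 1) (axis j 1))" .
  show "((\<lambda>q. g q (Y q) (Z q)) has_derivative
      (\<lambda>w. metric_deriv g p w (Y p) (Z p) + g p (Y' w) (Z p) + g p (Y p) (Z' w))) (at p)"
  proof (rule has_derivative_eq_rhs[OF T[OF Y Z]], rule ext)
    fix w
    show "(\<Sum>i\<in>UNIV. \<Sum>j\<in>UNIV. Y p $ i * Z p $ j * metric_deriv g p w (axis i 1) (axis j 1)
        + (Y p $ i * Z' w $ j + Y' w $ i * Z p $ j) * g p (axis i 1) (axis j 1)) =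
      metric_deriv g p w (Y p) (Z p) + g p (Y' w) (Z p) + g p (Y p) (Z' w)"
      unfolding md[of w "Y p" "Z p"] metric_expand[OF p, of "Y' w" "Z p"]
        metric_expand[OF p, of "Y p" "Z' w"]
      by (simp add: sum.distrib algebra_simps)
  qed
qed

lemma koszul:
  assumes p: "p \<in> U"
  shows "g p (christoffel g p u v) w =
    (metric_deriv g p u v w + metric_deriv g p v u w - metric_deriv g p w u v) / 2"
proof -
  let ?G = "metric_matrix g p" and ?H = "metric_inverse g p"
  let ?D = "\<lambda>i j k. metric_deriv g p (axis i 1) (axis j 1) (axis k 1)"
  let ?K = "\<lambda>i j l. (?D i j l + ?D j i l - ?D l i j) / 2"
  note md = has_derivative_metric(2)[OF p has_derivative_const has_derivative_const]
  have lin: "metric_deriv g p w u v = (\<Sum>l\<in>UNIV. w $ l * metric_deriv g p (axis l 1) u v)" for w u v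
  proof -
    have "linear (\<lambda>w. metric_deriv g p w u v)"
      unfolding metric_deriv_def
      using linear_frechet_derivative[OF metric_differentiable[OF p]] .
    then have "metric_deriv g p (\<Sum>l\<in>UNIV. w $ l *s axis l 1) u v
        = (\<Sum>l\<in>UNIV. metric_deriv g p (w $ l *s axis l 1) u v)"
      by (rule linear_sum)
    also have "\<dots> = (\<Sum>l\<in>UNIV. w $ l * metric_deriv g p (axis l 1) u v)"
      using linear_scale[OF \<open>linear (\<lambda>w. metric_deriv g p w u v)\<close>]
      by (simp add: scalar_mult_eq_scaleR)
    finally show ?thesis by (simp only: basis_expansion)
  qed
  have full: "metric_deriv g p w u v =
     (\<Sum>l\<in>UNIV. \<Sum>i\<in>UNIV. \<Sum>j\<in>UNIV. w $ l * u $ i * v $ j * ?D l i j)" for w u v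
    by (rule trans[OF lin sum.cong[OF refl]], rule trans[OF arg_cong[OF md]])
       (simp only: sum_distrib_left mult.assoc)
  have c: "(\<Sum>k\<in>UNIV. christoffel_symbol g p k i j * g p (axis k 1) (axis m 1)) = ?K i j m" for i j m
  proof -
    have HG: "(\<Sum>k\<in>UNIV. ?H $ l $ k * g p (axis k 1) (axis m 1)) = (if l = m then 1 else 0)" for l
      using metric_inverse_left[OF p]
      by (simp add: vec_eq_iff matrix_matrix_mult_def mat_def metric_matrix_def)
    have "(\<Sum>k\<in>UNIV. christoffel_symbol g p k i j * g p (axis k 1) (axis m 1))
      = (\<Sum>k\<in>UNIV. \<Sum>l\<in>UNIV. ?H $ l $ k * g p (axis k 1) (axis m 1) * ?K i j l)"
      unfolding christoffel_symbol_def
      by (simp add: sum_distrib_left sum_distrib_right mult_ac metric_inverse_sym[OF p])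
    also have "\<dots> = (\<Sum>l\<in>UNIV. (\<Sum>k\<in>UNIV. ?H $ l $ k * g p (axis k 1) (axis m 1)) * ?K i j l)"
      by (subst sum.swap) (simp only: sum_distrib_right)
    also have "\<dots> = ?K i j m"
      unfolding HG by (simp only: if_distrib[where f="\<lambda>x. x * _"] mult_1 mult_zero_left sum.delta finite UNIV_I if_True)
    finally show ?thesis .
  qed
  have "g p (christoffel g p u v) w
     = (\<Sum>k\<in>UNIV. \<Sum>m\<in>UNIV. (\<Sum>i\<in>UNIV. \<Sum>j\<in>UNIV. christoffel_symbol g p k i j * u $ i * v $ j)
          * w $ m * g p (axis k 1) (axis m 1))"
    by (subst metric_expand[OF p]) (simp add: christoffel_def)
  also have "\<dots> = (\<Sum>m\<in>UNIV. \<Sum>i\<in>UNIV. \<Sum>j\<in>UNIV. u $ i * v $ j * w $ m * 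
       (\<Sum>k\<in>UNIV. christoffel_symbol g p k i j * g p (axis k 1) (axis m 1)))"
  proof -
    have "(\<Sum>k\<in>UNIV. (\<Sum>i\<in>UNIV. \<Sum>j\<in>UNIV. christoffel_symbol g p k i j * u $ i * v $ j)
          * w $ m * g p (axis k 1) (axis m 1))
      = (\<Sum>i\<in>UNIV. \<Sum>j\<in>UNIV. u $ i * v $ j * w $ m * 
       (\<Sum>k\<in>UNIV. christoffel_symbol g p k i j * g p (axis k 1) (axis m 1)))" for m
    proof -
      have "(\<Sum>k\<in>UNIV. (\<Sum>i\<in>UNIV. \<Sum>j\<in>UNIV. christoffel_symbol g p k i j * u $ i * v $ j)
          * w $ m * g p (axis k 1) (axis m 1))
       = (\<Sum>k\<in>UNIV. \<Sum>i\<in>UNIV. \<Sum>j\<in>UNIV. u $ i * v $ j * w $ m * 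
           (christoffel_symbol g p k i j * g p (axis k 1) (axis m 1)))"
        by (simp add: sum_distrib_left sum_distrib_right mult_ac)
      also have "\<dots> = (\<Sum>i\<in>UNIV. \<Sum>k\<in>UNIV. \<Sum>j\<in>UNIV. u $ i * v $ j * w $ m * 
           (christoffel_symbol g p k i j * g p (axis k 1) (axis m 1)))"
        by (rule sum.swap)
      also have "\<dots> = (\<Sum>i\<in>UNIV. \<Sum>j\<in>UNIV. \<Sum>k\<in>UNIV. u $ i * v $ j * w $ m * 
           (christoffel_symbol g p k i j * g p (axis k 1) (axis m 1)))"
        by (intro sum.cong refl sum.swap)
      finally show ?thesis by (simp only: sum_distrib_left)
    qed
    then show ?thesis by (subst sum.swap) simp
  qed
  also have "\<dots> = (\<Sum>m\<in>UNIV. \<Sum>i\<in>UNIV. \<Sum>j\<in>UNIV. u $ i * v $ j * w $ m * ?K i j m)"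
    unfolding c ..
  also have "\<dots> = ((\<Sum>m\<in>UNIV. \<Sum>i\<in>UNIV. \<Sum>j\<in>UNIV. u $ i * v $ j * w $ m * ?D i j m)
     + (\<Sum>m\<in>UNIV. \<Sum>i\<in>UNIV. \<Sum>j\<in>UNIV. u $ i * v $ j * w $ m * ?D j i m)
     - (\<Sum>m\<in>UNIV. \<Sum>i\<in>UNIV. \<Sum>j\<in>UNIV. u $ i * v $ j * w $ m * ?D m i j)) / 2"
    by (simp add: sum.distrib sum_subtractf sum_divide_distrib diff_divide_distrib
        add_divide_distrib algebra_simps)
  also have "(\<Sum>m\<in>UNIV. \<Sum>i\<in>UNIV. \<Sum>j\<in>UNIV. u $ i * v $ j * w $ m * ?D i j m)
     = metric_deriv g p u v w"
  proof -
    have "(\<Sum>m\<in>UNIV. \<Sum>i\<in>UNIV. \<Sum>j\<in>UNIV. u $ i * v $ j * w $ m * ?D i j m)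
      = (\<Sum>i\<in>UNIV. \<Sum>m\<in>UNIV. \<Sum>j\<in>UNIV. u $ i * v $ j * w $ m * ?D i j m)"
      by (rule sum.swap)
    also have "\<dots> = (\<Sum>i\<in>UNIV. \<Sum>j\<in>UNIV. \<Sum>m\<in>UNIV. u $ i * v $ j * w $ m * ?D i j m)"
      by (intro sum.cong refl sum.swap)
    finally show ?thesis by (subst full) (simp add: mult_ac)
  qed
  also have "(\<Sum>m\<in>UNIV. \<Sum>i\<in>UNIV. \<Sum>j\<in>UNIV. u $ i * v $ j * w $ m * ?D j i m)
     = metric_deriv g p v u w"
  proof -
    have "(\<Sum>m\<in>UNIV. \<Sum>i\<in>UNIV. \<Sum>j\<in>UNIV. u $ i * v $ j * w $ m * ?D j i m)
      = (\<Sum>m\<in>UNIV. \<Sum>j\<in>UNIV. \<Sum>i\<in>UNIV. u $ i * v $ j * w $ m * ?D j i m)"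
      by (intro sum.cong refl sum.swap)
    also have "\<dots> = (\<Sum>j\<in>UNIV. \<Sum>m\<in>UNIV. \<Sum>i\<in>UNIV. u $ i * v $ j * w $ m * ?D j i m)"
      by (rule sum.swap)
    also have "\<dots> = (\<Sum>j\<in>UNIV. \<Sum>i\<in>UNIV. \<Sum>m\<in>UNIV. u $ i * v $ j * w $ m * ?D j i m)"
      by (intro sum.cong refl sum.swap)
    finally show ?thesis by (subst full) (simp add: mult_ac)
  qed
  also have "(\<Sum>m\<in>UNIV. \<Sum>i\<in>UNIV. \<Sum>j\<in>UNIV. u $ i * v $ j * w $ m * ?D m i j)
     = metric_deriv g p w u v"
    by (subst full) (simp add: mult_ac)
  finally show ?thesis .
qed

lemma metric_deriv_sym:
  assumes "p \<in> U" shows "metric_deriv g p w u v = metric_deriv g p w v u"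
proof -
  have "((\<lambda>q. g q u v) has_derivative (\<lambda>w. metric_deriv g p w u v)) (at p)"
    using metric_differentiable[OF assms, of u v] frechet_derivative_works
    unfolding metric_deriv_def by blast
  then have "((\<lambda>q. g q v u) has_derivative (\<lambda>w. metric_deriv g p w u v)) (at p)"
    by (rule has_derivative_transform_within_open[OF _ metric_open assms]) (rule metric_sym)
  from frechet_derivative_at[OF this] show ?thesis unfolding metric_deriv_def by metis
qed

lemma levi_civita_torsion_free:
  assumes p: "p \<in> U"
  shows "levi_civita g X Y p - levi_civita g Y X p = lie_bracket X Y p"
proof -
  have s: "christoffel_symbol g p k i j = christoffel_symbol g p k j i" for k i j
    unfolding christoffel_symbol_def 
    by (simp add: metric_deriv_sym[OF p] add.commute)
  have "christoffel g p u v = christoffel g p v u" for u v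
  proof -
    have "(\<Sum>i\<in>UNIV. \<Sum>j\<in>UNIV. christoffel_symbol g p k i j * u $ i * v $ j) =
      (\<Sum>i\<in>UNIV. \<Sum>j\<in>UNIV. christoffel_symbol g p k i j * v $ i * u $ j)" for k
      by (subst sum.swap) (intro sum.cong refl, subst s, simp add: mult_ac)
    then show ?thesis by (simp add: christoffel_def vec_eq_iff)
  qed
  then show ?thesis by (simp add: levi_civita_def lie_bracket_def)
qed

lemma levi_civita_metric:
  assumes p: "p \<in> U" and Y: "Y differentiable (at p)" and Z: "Z differentiable (at p)"
  shows "frechet_derivative (\<lambda>q. g q (Y q) (Z q)) (at p) (X p) =
         g p (levi_civita g X Y p) (Z p) + g p (Y p) (levi_civita g X Z p)"
proof -
  let ?u = "X p"
  have bl: "bilinear (g p)" using metric_bilinear[OF p] .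
  have "frechet_derivative (\<lambda>q. g q (Y q) (Z q)) (at p) ?u
     = metric_deriv g p ?u (Y p) (Z p) + g p (frechet_derivative Y (at p) ?u) (Z p)
       + g p (Y p) (frechet_derivative Z (at p) ?u)"
    using frechet_derivative_at[OF has_derivative_metric(1)[OF p
        Y[unfolded frechet_derivative_works] Z[unfolded frechet_derivative_works]], symmetric]
    by simp
  moreover have "g p (christoffel g p ?u (Y p)) (Z p) + g p (Y p) (christoffel g p ?u (Z p))
     = metric_deriv g p ?u (Y p) (Z p)"
    unfolding metric_sym[OF p, of "Y p"] koszul[OF p]
    using metric_deriv_sym[OF p] by (simp add: field_simps)
  ultimately show ?thesis
    by (simp add: levi_civita_def bilinear_ladd[OF bl] bilinear_radd[OF bl])
qed

end

section \<open>Tension and bitension field of a map\<close>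

definition pushforward ::
  "(real ^ 'n \<Rightarrow> real ^ 'm) \<Rightarrow> 'n::finite vfield \<Rightarrow> real ^ 'n \<Rightarrow> real ^ 'm::finite" where
  "pushforward \<phi> X p = frechet_derivative \<phi> (at p) (X p)"

text \<open>\<open>pullback_connection h \<phi> X V\<close> is \<open>\<nabla>\<^sup>\<phi>\<^sub>X V\<close> for a section \<open>V\<close> along \<open>\<phi>\<close>,
  where \<open>h\<close> is the metric of the target.\<close>

definition pullback_connection ::
  "'m::finite tensor2 \<Rightarrow> (real ^ 'n \<Rightarrow> real ^ 'm) \<Rightarrow> 'n::finite vfield \<Rightarrow>
   (real ^ 'n \<Rightarrow> real ^ 'm) \<Rightarrow> real ^ 'n \<Rightarrow> real ^ 'm" where
  "pullback_connection h \<phi> X V p =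
     frechet_derivative V (at p) (X p) + christoffel h (\<phi> p) (pushforward \<phi> X p) (V p)"

definition second_fundamental_form ::
  "'n::finite tensor2 \<Rightarrow> 'm::finite tensor2 \<Rightarrow> (real ^ 'n \<Rightarrow> real ^ 'm) \<Rightarrow>
   'n vfield \<Rightarrow> 'n vfield \<Rightarrow> real ^ 'n \<Rightarrow> real ^ 'm" where
  "second_fundamental_form g h \<phi> X Y p =
     pullback_connection h \<phi> X (pushforward \<phi> Y) p - pushforward \<phi> (levi_civita g X Y) p"

definition tension ::
  "'n::finite tensor2 \<Rightarrow> 'm::finite tensor2 \<Rightarrow> (real ^ 'n \<Rightarrow> real ^ 'm) \<Rightarrow> real ^ 'n \<Rightarrow> real ^ 'm" where
  "tension g h \<phi> p =
     metric_trace g p (\<lambda>u v. second_fundamental_form g h \<phi> (\<lambda>_. u) (\<lambda>_. v) p)"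

definition second_covariant_derivative ::
  "'n::finite tensor2 \<Rightarrow> 'm::finite tensor2 \<Rightarrow> (real ^ 'n \<Rightarrow> real ^ 'm) \<Rightarrow>
   'n vfield \<Rightarrow> 'n vfield \<Rightarrow> (real ^ 'n \<Rightarrow> real ^ 'm) \<Rightarrow> real ^ 'n \<Rightarrow> real ^ 'm" where
  "second_covariant_derivative g h \<phi> X Y V p =
     pullback_connection h \<phi> X (pullback_connection h \<phi> Y V) p
     - pullback_connection h \<phi> (levi_civita g X Y) V p"

definition bitension ::
  "'n::finite tensor2 \<Rightarrow> 'm::finite tensor2 \<Rightarrow> (real ^ 'n \<Rightarrow> real ^ 'm) \<Rightarrow> real ^ 'n \<Rightarrow> real ^ 'm" where
  "bitension g h \<phi> p =
     metric_trace g p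
       (\<lambda>u v. second_covariant_derivative g h \<phi> (\<lambda>_. u) (\<lambda>_. v) (tension g h \<phi>) p)
     - metric_trace g p
       (\<lambda>u v. curvature_at h (\<phi> p) (frechet_derivative \<phi> (at p) u) (tension g h \<phi> p)
                (frechet_derivative \<phi> (at p) v))"

section \<open>Classes of maps between Riemannian manifolds\<close>

definition smooth_riemannian_map ::
  "(real ^ 'n::finite) set \<Rightarrow> 'n tensor2 \<Rightarrow> (real ^ 'm::finite) set \<Rightarrow> 'm tensor2 \<Rightarrow>
   (real ^ 'n \<Rightarrow> real ^ 'm) \<Rightarrow> bool" where
  "smooth_riemannian_map U g V h \<phi> \<longleftrightarrow>
     riemannian_metric_on U g \<and> riemannian_metric_on V h \<and> \<phi> ` U \<subseteq> V \<and> smooth_on U \<phi>"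

definition harmonic_map ::
  "(real ^ 'n::finite) set \<Rightarrow> 'n tensor2 \<Rightarrow> (real ^ 'm::finite) set \<Rightarrow> 'm tensor2 \<Rightarrow>
   (real ^ 'n \<Rightarrow> real ^ 'm) \<Rightarrow> bool" where
  "harmonic_map U g V h \<phi> \<longleftrightarrow>
     smooth_riemannian_map U g V h \<phi> \<and> (\<forall>p\<in>U. tension g h \<phi> p = 0)"

definition biharmonic_map ::
  "(real ^ 'n::finite) set \<Rightarrow> 'n tensor2 \<Rightarrow> (real ^ 'm::finite) set \<Rightarrow> 'm tensor2 \<Rightarrow>
   (real ^ 'n \<Rightarrow> real ^ 'm) \<Rightarrow> bool" where
  "biharmonic_map U g V h \<phi> \<longleftrightarrow>
     smooth_riemannian_map U g V h \<phi> \<and> (\<forall>p\<in>U. bitension g h \<phi> p = 0)"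

definition proper_biharmonic_map ::
  "(real ^ 'n::finite) set \<Rightarrow> 'n tensor2 \<Rightarrow> (real ^ 'm::finite) set \<Rightarrow> 'm tensor2 \<Rightarrow>
   (real ^ 'n \<Rightarrow> real ^ 'm) \<Rightarrow> bool" where
  "proper_biharmonic_map U g V h \<phi> \<longleftrightarrow> biharmonic_map U g V h \<phi> \<and> \<not> harmonic_map U g V h \<phi>"

definition horizontal_space ::
  "'n::finite tensor2 \<Rightarrow> (real ^ 'n \<Rightarrow> real ^ 'm::finite) \<Rightarrow> real ^ 'n \<Rightarrow> (real ^ 'n) set" where
  "horizontal_space g \<phi> p = {u. \<forall>w. frechet_derivative \<phi> (at p) w = 0 \<longrightarrow> g p u w = 0}"

text \<open>As in O'Neill, a Riemannian submersion is required to be onto.\<close>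

definition riemannian_submersion ::
  "(real ^ 'n::finite) set \<Rightarrow> 'n tensor2 \<Rightarrow> (real ^ 'm::finite) set \<Rightarrow> 'm tensor2 \<Rightarrow>
   (real ^ 'n \<Rightarrow> real ^ 'm) \<Rightarrow> bool" where
  "riemannian_submersion U g V h \<phi> \<longleftrightarrow>
     smooth_riemannian_map U g V h \<phi> \<and> \<phi> ` U = V \<and>
     (\<forall>p\<in>U. surj (frechet_derivative \<phi> (at p)) \<and>
       (\<forall>u\<in>horizontal_space g \<phi> p. \<forall>v\<in>horizontal_space g \<phi> p.
          h (\<phi> p) (frechet_derivative \<phi> (at p) u) (frechet_derivative \<phi> (at p) v) = g p u v))"

section \<open>The spaces and the projection\<close>

text \<open>Points of \<open>real ^ 3\<close> are \<open>(x, y, z)\<close>; points of \<open>real ^ 2\<close> are \<open>(y, z)\<close>, so that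
  \<open>y\<close> is component \<open>2\<close> upstairs and component \<open>1\<close> downstairs.\<close>

definition upper_half_space :: "(real ^ 3) set" where
  "upper_half_space = {p. p $ 2 > 0}"

definition half_plane :: "(real ^ 2) set" where
  "half_plane = {q. q $ 1 > 0}"

definition total_metric :: "real \<Rightarrow> real \<Rightarrow> 3 tensor2" where
  "total_metric a b p u v =
     a\<^sup>2 * (u $ 1 * v $ 1 + u $ 2 * v $ 2) / (p $ 2)\<^sup>2
     + (u $ 3 + b * a / p $ 2 * u $ 1) * (v $ 3 + b * a / p $ 2 * v $ 1)"

definition base_metric :: "real \<Rightarrow> real \<Rightarrow> 2 tensor2" where
  "base_metric a b q u v =
     a\<^sup>2 * (u $ 1 * v $ 1) / (q $ 1)\<^sup>2 + u $ 2 * v $ 2 / (1 + b\<^sup>2)"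

definition yz_projection :: "real ^ 3 \<Rightarrow> real ^ 2" where
  "yz_projection p = vector [p $ 2, p $ 3]"

end

theory Submission imports Defs begin

text \<open>
  The fibres are the lines in direction \<open>\<partial>\<^sub>x\<close>.  Orthogonality to \<open>\<partial>\<^sub>x\<close> expresses the
  \<open>x\<close>-component of a horizontal vector through its \<open>z\<close>-component (\<open>horizontal_yz_projection\<close>);
  after this substitution the total metric becomes the base metric, so the projection is a
  Riemannian submersion.

  Two facts make it proper biharmonic.  The base is flat: its only nonzero Christoffel symbol is
  \<open>\<Gamma>\<^sup>1\<^sub>1\<^sub>1 = - 1 / y\<close>, as \<open>ln y\<close> and \<open>z\<close> are, up to scaling, Cartesian coordinates
  (\<open>christoffel_base\<close>, \<open>curvature_base\<close>).  And the tension field is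
  \<open>\<tau> = (- y / a\<^sup>2, 0)\<close> (\<open>tension_yz_projection\<close>), because \<open>y\<close> and \<open>z\<close> satisfy
  \<open>g\<^sup>i\<^sup>j \<Gamma>\<^sup>k\<^sub>i\<^sub>j = 0\<close> upstairs, so that only the Christoffel symbol of the base
  contributes.  Thus \<open>\<tau>\<close> is nowhere zero, yet it is the constant multiple \<open>- 1 / a\<close> of the unit field
  \<open>(y / a) \<partial>\<^sub>y\<close>, which is parallel in the flat base (\<open>tension_parallel\<close>).  Each of the two terms
  of the bitension field then vanishes, one by parallelism and one by flatness.
\<close>

section \<open>Smoothness of the metrics and of the projection\<close>

lemma Ck_on_cong:
  assumes "Ck_on k U f" "open U" "\<And>x. x \<in> U \<Longrightarrow> f x = g x"
  shows "Ck_on k U g"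
  using assms
proof (induction k arbitrary: f g)
  case 0
  then show ?case using continuous_on_cong[of U U f g] by simp
next
  case (Suc k)
  have D: "(g has_derivative frechet_derivative f (at x)) (at x)" if "x \<in> U" for x
  proof -
    have "f differentiable (at x)"
      using Suc.prems that differentiable_on_eq_differentiable_at by auto
    then have "(f has_derivative frechet_derivative f (at x)) (at x)"
      by (simp add: frechet_derivative_works)
    from has_derivative_transform_within_open[OF this \<open>open U\<close> that Suc.prems(3)]
    show ?thesis .
  qed
  then have "g differentiable_on U"
    unfolding differentiable_on_eq_differentiable_at[OF \<open>open U\<close>] differentiable_def by blast
  moreover have "Ck_on k U (\<lambda>x. frechet_derivative g (at x) v)" for v
    by (rule Suc.IH[of "\<lambda>x. frechet_derivative f (at x) v"])
      (use Suc.prems frechet_derivative_at[OF D] in auto)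
  ultimately show ?case by simp
qed

text \<open>
  Polynomials in the reciprocal of a coordinate are closed under differentiation, since
  \<open>\<partial> P (1 / t) = - (1 / t)\<^sup>2 P' (1 / t)\<close>, so a single induction gives all orders; all
  components of both metrics have this form.
\<close>

lemma Ck_on_poly_reciprocal:
  fixes U :: "(real ^ 'n::finite) set" and P :: "real poly"
  assumes "open U" and nz: "\<And>p. p \<in> U \<Longrightarrow> p $ i \<noteq> 0"
  shows "Ck_on k U (\<lambda>p. poly P (1 / p $ i))"
proof -
  have D: "((\<lambda>p. poly P (1 / p $ i)) has_derivative
      (\<lambda>v. poly (smult (- (v $ i)) ([:0, 0, 1:] * pderiv P)) (1 / p $ i))) (at p)"
    if "p \<in> U" for p P
  proof -
    have "((\<lambda>p. 1 / p $ i) has_derivative (\<lambda>v. - (v $ i) * (1 / p $ i)\<^sup>2)) (at p)"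
      using nz[OF that]
      by (auto intro!: derivative_eq_intros bounded_linear.has_derivative[OF bounded_linear_vec_nth]
            simp: power2_eq_square field_simps)
    then have "((\<lambda>p. poly P (1 / p $ i)) has_derivative
        (\<lambda>v. poly (pderiv P) (1 / p $ i) * (- (v $ i) * (1 / p $ i)\<^sup>2))) (at p)"
      using has_derivative_compose[OF _ poly_DERIV[unfolded has_field_derivative_def]] by blast
    then show ?thesis
      by (rule has_derivative_eq_rhs) (auto simp: power2_eq_square)
  qed
  then have diff: "(\<lambda>p. poly P (1 / p $ i)) differentiable_on U" for P
    unfolding differentiable_on_eq_differentiable_at[OF \<open>open U\<close>] differentiable_def by blast
  show ?thesis
  proof (induction k arbitrary: P)
    case 0
    then show ?case using differentiable_imp_continuous_on[OF diff] by simp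
  next
    case (Suc k)
    have "Ck_on k U (\<lambda>p. frechet_derivative (\<lambda>p. poly P (1 / p $ i)) (at p) v)" for v
    proof (rule Ck_on_cong[OF Suc \<open>open U\<close>])
      fix p assume "p \<in> U"
      show "poly (smult (- (v $ i)) ([:0, 0, 1:] * pderiv P)) (1 / p $ i)
          = frechet_derivative (\<lambda>p. poly P (1 / p $ i)) (at p) v"
        using frechet_derivative_at[OF D[OF \<open>p \<in> U\<close>, of P]] by metis
    qed
    then show ?case using diff by simp
  qed
qed

lemma frechet_derivative_bounded_linear:
  "bounded_linear f \<Longrightarrow> frechet_derivative f (at p) = f"
  by (metis bounded_linear_imp_has_derivative frechet_derivative_at)

lemma smooth_on_bounded_linear:
  assumes "bounded_linear f"
  shows "smooth_on U f"
proof -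
  have const: "Ck_on k U (\<lambda>x. c)" for k and c :: 'b
    by (induction k arbitrary: c) (auto simp: frechet_derivative_const)
  have "Ck_on k U f" for k
    using assms const
    by (cases k) (auto simp: frechet_derivative_bounded_linear linear_continuous_on
        bounded_linear_imp_differentiable_on)
  then show ?thesis by (simp add: smooth_on_def)
qed

lemma bounded_linear_yz_projection: "bounded_linear yz_projection"
  unfolding linear_conv_bounded_linear[symmetric]
  by (rule linearI) (simp_all add: yz_projection_def vec_eq_iff forall_2)

lemma yz_projection_nth [simp]: "yz_projection p $ 1 = p $ 2" "yz_projection p $ 2 = p $ 3"
  by (simp_all add: yz_projection_def)

lemmas frechet_derivative_yz_projection [simp] =
  frechet_derivative_bounded_linear[OF bounded_linear_yz_projection]

lemma open_upper_half_space: "open upper_half_space"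
  unfolding upper_half_space_def by (intro open_Collect_less continuous_intros)

lemma open_half_plane: "open half_plane"
  unfolding half_plane_def by (intro open_Collect_less continuous_intros)

lemma riemannian_metric_total:
  assumes "a > 0"
  shows "riemannian_metric_on upper_half_space (total_metric a b)"
  unfolding riemannian_metric_on_def
proof (intro conjI ballI allI impI open_upper_half_space)
  fix p u v :: "real ^ 3"
  show "bilinear (total_metric a b p)"
    unfolding bilinear_def
    by (auto intro!: linearI simp: total_metric_def add_divide_distrib algebra_simps)
  show "total_metric a b p u v = total_metric a b p v u"
    by (simp add: total_metric_def mult.commute)
next
  fix p v :: "real ^ 3" assume "p \<in> upper_half_space" "v \<noteq> 0"
  then have y: "p $ 2 > 0" by (simp add: upper_half_space_def)
  have eq: "total_metric a b p v v = a\<^sup>2 * ((v $ 1)\<^sup>2 + (v $ 2)\<^sup>2) / (p $ 2)\<^sup>2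
      + (v $ 3 + b * a / p $ 2 * v $ 1)\<^sup>2"
    by (simp add: total_metric_def power2_eq_square)
  show "total_metric a b p v v > 0"
  proof (cases "v $ 1 = 0 \<and> v $ 2 = 0")
    case True
    with \<open>v \<noteq> 0\<close> have "v $ 3 \<noteq> 0" by (auto simp: vec_eq_iff forall_3)
    with True show ?thesis by (simp add: eq)
  next
    case False
    then have "(v $ 1)\<^sup>2 + (v $ 2)\<^sup>2 > 0" by (simp add: sum_power2_gt_zero_iff)
    then have "a\<^sup>2 * ((v $ 1)\<^sup>2 + (v $ 2)\<^sup>2) / (p $ 2)\<^sup>2 > 0" using assms y by simp
    then show ?thesis unfolding eq by (simp add: add_pos_nonneg)
  qed
next
  fix u v :: "real ^ 3"
  have "(\<lambda>p. total_metric a b p u v) = (\<lambda>p. poly [: u $ 3 * v $ 3, a * b * (u $ 1 * v $ 3 + u $ 3 * v $ 1),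
      a\<^sup>2 * (u $ 1 * v $ 1 + u $ 2 * v $ 2) + a\<^sup>2 * b\<^sup>2 * (u $ 1 * v $ 1) :] (1 / p $ 2))"
    by (rule ext) (simp add: total_metric_def power2_eq_square algebra_simps add_divide_distrib)
  then show "smooth_on upper_half_space (\<lambda>p. total_metric a b p u v)"
    unfolding smooth_on_def
    by (simp only:) (intro allI Ck_on_poly_reciprocal open_upper_half_space, simp add: upper_half_space_def)
qed

lemma riemannian_metric_base:
  assumes "a > 0"
  shows "riemannian_metric_on half_plane (base_metric a b)"
  unfolding riemannian_metric_on_def
proof (intro conjI ballI allI impI open_half_plane)
  fix p u v :: "real ^ 2"
  show "bilinear (base_metric a b p)"
    unfolding bilinear_def
    by (auto intro!: linearI simp: base_metric_def add_divide_distrib algebra_simps)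
  show "base_metric a b p u v = base_metric a b p v u"
    by (simp add: base_metric_def mult.commute)
next
  fix p v :: "real ^ 2" assume "p \<in> half_plane" "v \<noteq> 0"
  then have y: "p $ 1 > 0" by (simp add: half_plane_def)
  have b: "1 + b\<^sup>2 > 0" by (simp add: add_pos_nonneg)
  have eq: "base_metric a b p v v = a\<^sup>2 * (v $ 1)\<^sup>2 / (p $ 1)\<^sup>2 + (v $ 2)\<^sup>2 / (1 + b\<^sup>2)"
    by (simp add: base_metric_def power2_eq_square)
  show "base_metric a b p v v > 0"
  proof (cases "v $ 1 = 0")
    case True
    with \<open>v \<noteq> 0\<close> have "v $ 2 \<noteq> 0" by (auto simp: vec_eq_iff forall_2)
    with True b show ?thesis by (simp add: eq)
  next
    case False
    then have "a\<^sup>2 * (v $ 1)\<^sup>2 / (p $ 1)\<^sup>2 > 0" using assms y by simp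
    then show ?thesis unfolding eq using b by (simp add: add_pos_nonneg)
  qed
next
  fix u v :: "real ^ 2"
  have "(\<lambda>p. base_metric a b p u v) =
      (\<lambda>p. poly [: u $ 2 * v $ 2 / (1 + b\<^sup>2), 0, a\<^sup>2 * (u $ 1 * v $ 1) :] (1 / p $ 1))"
    by (rule ext) (simp add: base_metric_def power2_eq_square)
  then show "smooth_on half_plane (\<lambda>p. base_metric a b p u v)"
    unfolding smooth_on_def
    by (simp only:) (intro allI Ck_on_poly_reciprocal open_half_plane, simp add: half_plane_def)
qed

lemma yz_projection_image: "yz_projection ` upper_half_space = half_plane"
proof
  show "yz_projection ` upper_half_space \<subseteq> half_plane"
    by (auto simp: upper_half_space_def half_plane_def)
  show "half_plane \<subseteq> yz_projection ` upper_half_space"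
  proof
    fix q assume "q \<in> half_plane"
    then show "q \<in> yz_projection ` upper_half_space"
      by (intro image_eqI[of _ _ "vector [0, q $ 1, q $ 2]"])
        (auto simp: upper_half_space_def half_plane_def vec_eq_iff forall_2)
  qed
qed

lemma smooth_riemannian_map_yz_projection:
  assumes "a > 0"
  shows "smooth_riemannian_map upper_half_space (total_metric a b)
    half_plane (base_metric a b) yz_projection"
  using riemannian_metric_total[OF assms] riemannian_metric_base[OF assms] yz_projection_image
    smooth_on_bounded_linear[OF bounded_linear_yz_projection]
  by (simp add: smooth_riemannian_map_def)

section \<open>The Riemannian submersion\<close>

text \<open>This is the equation \<open>g (u, \<partial>\<^sub>x) = 0\<close>, solved for \<open>u\<^sub>1\<close>.\<close>

lemma horizontal_yz_projection:
  assumes "a > 0" "p $ 2 > 0" "u \<in> horizontal_space (total_metric a b) yz_projection p"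
  shows "u $ 1 = - (b * p $ 2 * u $ 3) / (a * (1 + b\<^sup>2))"
proof -
  have "yz_projection (axis 1 1) = 0" by (simp add: vec_eq_iff forall_2 axis_def)
  then have "total_metric a b p u (axis 1 1) = 0"
    using assms(3) by (simp add: horizontal_space_def)
  then have "a * (u $ 1 * (a * (1 + b\<^sup>2)) + b * p $ 2 * u $ 3) = 0"
    using assms(2) by (simp add: total_metric_def axis_def field_simps power2_eq_square)
  then have *: "u $ 1 * (a * (1 + b\<^sup>2)) + b * p $ 2 * u $ 3 = 0" using assms(1) by simp
  have "1 + b\<^sup>2 > 0" by (simp add: add_pos_nonneg)
  then have "a * (1 + b\<^sup>2) \<noteq> 0" using assms(1) by simp
  moreover have "u $ 1 * (a * (1 + b\<^sup>2)) = - (b * p $ 2 * u $ 3)" using * by linarith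
  ultimately show ?thesis by (simp only: nonzero_eq_divide_eq not_False_eq_True)
qed

lemma riemannian_submersion_yz_projection:
  assumes a: "a > 0"
  shows "riemannian_submersion upper_half_space (total_metric a b)
    half_plane (base_metric a b) yz_projection"
  unfolding riemannian_submersion_def frechet_derivative_yz_projection
proof (intro conjI ballI smooth_riemannian_map_yz_projection[OF a] yz_projection_image)
  fix p assume "p \<in> upper_half_space"
  then have y: "p $ 2 > 0" by (simp add: upper_half_space_def)
  show "surj yz_projection"
    by (rule surjI[of _ "\<lambda>q. vector [0, q $ 1, q $ 2]"]) (simp add: vec_eq_iff forall_2)
  fix u v
  assume "u \<in> horizontal_space (total_metric a b) yz_projection p"
    and "v \<in> horizontal_space (total_metric a b) yz_projection p"
  note uv = this[THEN horizontal_yz_projection[OF a y]]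
  define B where "B = 1 + b\<^sup>2"
  have B: "B > 0" by (simp add: B_def add_pos_nonneg)
  \<comment> \<open>On horizontal vectors, \<open>dz + (b a / y) dx\<close> is \<open>dz / (1 + b\<^sup>2)\<close>, and \<open>(a / y) dx\<close> is
    \<open>- b dz / (1 + b\<^sup>2)\<close>; the squares of the two add up to \<open>dz\<^sup>2 / (1 + b\<^sup>2)\<close>.\<close>
  have third: "w $ 3 + b * a / p $ 2 * w $ 1 = w $ 3 / B"
    if "w $ 1 = - (b * p $ 2 * w $ 3) / (a * B)" for w :: "real ^ 3"
  proof -
    have "b * a / p $ 2 * w $ 1 = - (b\<^sup>2 * w $ 3) / B"
      unfolding that using a y B by (simp add: field_simps power2_eq_square)
    moreover have "w $ 3 = (w $ 3 + b\<^sup>2 * w $ 3) / B"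
      using B by (simp add: B_def field_simps)
    ultimately show ?thesis by (simp add: add_divide_distrib)
  qed
  have "a\<^sup>2 * (u $ 1 * v $ 1) / (p $ 2)\<^sup>2 = b\<^sup>2 * (u $ 3 * v $ 3) / B\<^sup>2"
    unfolding uv B_def[symmetric] using a y B by (simp add: field_simps power2_eq_square)
  then have "total_metric a b p u v = a\<^sup>2 * (u $ 2 * v $ 2) / (p $ 2)\<^sup>2
      + (b\<^sup>2 * (u $ 3 * v $ 3) / B\<^sup>2 + u $ 3 / B * (v $ 3 / B))"
    unfolding total_metric_def uv[folded B_def, THEN third]
    by (simp add: distrib_left add_divide_distrib)
  also have "b\<^sup>2 * (u $ 3 * v $ 3) / B\<^sup>2 + u $ 3 / B * (v $ 3 / B) = B * (u $ 3 * v $ 3) / B\<^sup>2"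
    by (simp add: B_def power2_eq_square add_divide_distrib distrib_right)
  also have "\<dots> = u $ 3 * v $ 3 / B" using B by (simp add: power2_eq_square)
  finally show "base_metric a b (yz_projection p) (yz_projection u) (yz_projection v)
      = total_metric a b p u v"
    by (simp add: base_metric_def B_def)
qed

section \<open>The flat base\<close>

lemma metric_inverse_unique:
  assumes "riemannian_metric_on U g" "p \<in> U" "metric_matrix g p ** K = mat 1"
  shows "metric_inverse g p = K"
  by (metis assms metric_inverse_left matrix_mul_assoc matrix_mul_lid matrix_mul_rid)

lemma metric_inverse_base:
  assumes "a > 0" "q $ 1 > 0"
  shows "metric_inverse (base_metric a b) q =
    vector [vector [(q $ 1)\<^sup>2 / a\<^sup>2, 0], vector [0, 1 + b\<^sup>2]]"
proof (rule metric_inverse_unique[OF riemannian_metric_base[OF assms(1)]])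
  show "q \<in> half_plane" using assms by (simp add: half_plane_def)
  have "1 + b\<^sup>2 \<noteq> 0" by (metis add_pos_nonneg less_irrefl zero_le_power2 zero_less_one)
  then show "metric_matrix (base_metric a b) q **
      vector [vector [(q $ 1)\<^sup>2 / a\<^sup>2, 0], vector [0, 1 + b\<^sup>2]] = mat 1"
    using assms
    by (simp add: vec_eq_iff forall_2 matrix_matrix_mult_def sum_2 metric_matrix_def mat_def
        base_metric_def axis_def)
qed

lemma metric_deriv_base:
  assumes "q $ 1 > 0"
  shows "metric_deriv (base_metric a b) q w u v = - 2 * a\<^sup>2 * (u $ 1 * v $ 1) * w $ 1 / (q $ 1) ^ 3"
proof -
  have "((\<lambda>q. base_metric a b q u v) has_derivative
      (\<lambda>w. - 2 * a\<^sup>2 * (u $ 1 * v $ 1) * w $ 1 / (q $ 1) ^ 3)) (at q)"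
    unfolding base_metric_def using assms
    by (auto intro!: derivative_eq_intros bounded_linear.has_derivative[OF bounded_linear_vec_nth]
        simp: field_simps power2_eq_square power3_eq_cube)
  from frechet_derivative_at[OF this] show ?thesis unfolding metric_deriv_def by metis
qed

lemma christoffel_base:
  assumes "a > 0" "q $ 1 > 0"
  shows "christoffel (base_metric a b) q u v = vector [- (u $ 1 * v $ 1) / q $ 1, 0]"
  using assms
  by (simp add: christoffel_def christoffel_symbol_def vec_eq_iff forall_2 sum_2
      metric_inverse_base metric_deriv_base axis_def)
    (simp add: field_simps power2_eq_square power3_eq_cube)

text \<open>
  On constant fields, \<open>\<nabla>\<^sub>u \<nabla>\<^sub>v w\<close> has first component \<open>2 u\<^sub>1 v\<^sub>1 w\<^sub>1 / y\<^sup>2\<close>,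
  which is symmetric in \<open>u\<close> and \<open>v\<close>.
\<close>

lemma curvature_base:
  assumes a: "a > 0" and q: "q $ 1 > 0"
  shows "curvature_at (base_metric a b) q u v w = 0"
proof -
  have D: "frechet_derivative (levi_civita (base_metric a b) (\<lambda>_. v) (\<lambda>_. w)) (at q)
      = (\<lambda>u. vector [u $ 1 * v $ 1 * w $ 1 / (q $ 1)\<^sup>2, 0])" for v w
  proof -
    have "((\<lambda>q. - (v $ 1 * w $ 1) / q $ 1) has_derivative
        (\<lambda>u. u $ 1 * v $ 1 * w $ 1 / (q $ 1)\<^sup>2)) (at q)"
      using q by (auto intro!: derivative_eq_intros
          bounded_linear.has_derivative[OF bounded_linear_vec_nth]
          simp: field_simps power2_eq_square)
    then have "((\<lambda>q. (- (v $ 1 * w $ 1) / q $ 1) *\<^sub>R axis 1 1) has_derivative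
        (\<lambda>u. (u $ 1 * v $ 1 * w $ 1 / (q $ 1)\<^sup>2) *\<^sub>R axis 1 1)) (at q)"
      by (rule has_derivative_scaleR_left)
    then have "(levi_civita (base_metric a b) (\<lambda>_. v) (\<lambda>_. w) has_derivative
        (\<lambda>u. (u $ 1 * v $ 1 * w $ 1 / (q $ 1)\<^sup>2) *\<^sub>R axis 1 1)) (at q)"
    proof (rule has_derivative_transform_within_open[OF _ open_half_plane])
      show "q \<in> half_plane" using q by (simp add: half_plane_def)
    qed (auto simp: levi_civita_def half_plane_def christoffel_base[OF a]
        frechet_derivative_const vec_eq_iff forall_2 axis_def)
    then show ?thesis
      by (subst frechet_derivative_at[symmetric]) (auto simp: vec_eq_iff forall_2 axis_def fun_eq_iff)
  qed
  show ?thesis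
    unfolding curvature_at_def curvature_def
    by (subst (1 2 3) levi_civita_def)
      (simp add: D lie_bracket_def christoffel_base[OF a q] frechet_derivative_const
        levi_civita_def vec_eq_iff forall_2 mult_ac)
qed

section \<open>The tension field\<close>

lemma metric_inverse_total:
  assumes "a > 0" "p $ 2 > 0"
  shows "metric_inverse (total_metric a b) p =
    vector [vector [(p $ 2)\<^sup>2 / a\<^sup>2, 0, - (b * p $ 2 / a)],
            vector [0, (p $ 2)\<^sup>2 / a\<^sup>2, 0],
            vector [- (b * p $ 2 / a), 0, 1 + b\<^sup>2]]"
proof (rule metric_inverse_unique[OF riemannian_metric_total[OF assms(1)]])
  show "p \<in> upper_half_space" using assms by (simp add: upper_half_space_def)
  show "metric_matrix (total_metric a b) p **
      vector [vector [(p $ 2)\<^sup>2 / a\<^sup>2, 0, - (b * p $ 2 / a)],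
            vector [0, (p $ 2)\<^sup>2 / a\<^sup>2, 0],
            vector [- (b * p $ 2 / a), 0, 1 + b\<^sup>2]] = mat 1"
    using assms
    by (simp add: vec_eq_iff forall_3 matrix_matrix_mult_def sum_3 metric_matrix_def mat_def
        total_metric_def axis_def)
      (simp add: field_simps power2_eq_square)
qed

lemma metric_deriv_total:
  assumes "p $ 2 > 0"
  shows "metric_deriv (total_metric a b) p w u v =
    - (w $ 2) * (2 * a\<^sup>2 * ((1 + b\<^sup>2) * (u $ 1 * v $ 1) + u $ 2 * v $ 2) / (p $ 2) ^ 3
       + a * b * (u $ 1 * v $ 3 + u $ 3 * v $ 1) / (p $ 2)\<^sup>2)"
proof -
  have "((\<lambda>p. total_metric a b p u v) has_derivative (\<lambda>w.
      - (w $ 2) * (2 * a\<^sup>2 * ((1 + b\<^sup>2) * (u $ 1 * v $ 1) + u $ 2 * v $ 2) / (p $ 2) ^ 3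
       + a * b * (u $ 1 * v $ 3 + u $ 3 * v $ 1) / (p $ 2)\<^sup>2))) (at p)"
    unfolding total_metric_def using assms
    by (auto intro!: derivative_eq_intros bounded_linear.has_derivative[OF bounded_linear_vec_nth]
        simp: field_simps power2_eq_square power3_eq_cube)
  from frechet_derivative_at[OF this] show ?thesis unfolding metric_deriv_def by metis
qed

text \<open>
  Since \<open>- g\<^sup>i\<^sup>j \<Gamma>\<^sup>k\<^sub>i\<^sub>j\<close> is the Laplacian of the \<open>k\<close>-th coordinate, this says that
  \<open>y\<close> and \<open>z\<close> are harmonic functions on the total space.  For \<open>y\<close> the contributions of
  \<open>(x, x)\<close>, of \<open>(x, z)\<close> with \<open>(z, x)\<close>, and of \<open>(y, y)\<close> are proportional to \<open>1 + b\<^sup>2\<close>,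
  \<open>- b\<^sup>2\<close> and \<open>- 1\<close>; for \<open>z\<close> each contribution vanishes.
\<close>

lemma trace_christoffel_total:
  assumes a: "a > 0" and y: "p $ 2 > 0"
  shows "yz_projection (metric_trace (total_metric a b) p (christoffel (total_metric a b) p)) = 0"
  using assms
  by (simp add: vec_eq_iff forall_2 metric_trace_def christoffel_def christoffel_symbol_def sum_3
      metric_inverse_total metric_deriv_total axis_def)
    (simp add: field_simps power2_eq_square power3_eq_cube power4_eq_xxxx)

lemma tension_yz_projection:
  assumes a: "a > 0" and y: "p $ 2 > 0"
  shows "tension (total_metric a b) (base_metric a b) yz_projection p = vector [- (p $ 2) / a\<^sup>2, 0]"
proof -
  let ?tr = "metric_trace (total_metric a b) p"
  have "second_fundamental_form (total_metric a b) (base_metric a b) yz_projection (\<lambda>_. u) (\<lambda>_. v) p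
      = christoffel (base_metric a b) (yz_projection p) (yz_projection u) (yz_projection v)
        - yz_projection (christoffel (total_metric a b) p u v)" for u v
    by (simp add: second_fundamental_form_def pullback_connection_def pushforward_def[abs_def]
        levi_civita_def frechet_derivative_const)
  then have "tension (total_metric a b) (base_metric a b) yz_projection p =
      ?tr (\<lambda>u v. christoffel (base_metric a b) (yz_projection p) (yz_projection u) (yz_projection v))
      - yz_projection (?tr (christoffel (total_metric a b) p))"
    using bounded_linear.linear[OF bounded_linear_yz_projection]
    by (simp add: tension_def metric_trace_def linear_sum linear_scale sum_subtractf
        scaleR_diff_right)
  then show ?thesis
    using assms
    by (simp add: trace_christoffel_total christoffel_base)
      (simp add: metric_trace_def metric_inverse_total sum_3 axis_def vec_eq_iff forall_2
        power2_eq_square)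
qed

text \<open>
  Differentiating \<open>- y / a\<^sup>2\<close> along \<open>X\<close> gives \<open>- X\<^sub>2 / a\<^sup>2\<close>, which the Christoffel term
  \<open>- (1 / y) X\<^sub>2 (- y / a\<^sup>2)\<close> cancels.
\<close>

lemma tension_parallel:
  assumes a: "a > 0" and y: "p $ 2 > 0"
  shows "pullback_connection (base_metric a b) yz_projection X
    (tension (total_metric a b) (base_metric a b) yz_projection) p = 0"
proof -
  have "((\<lambda>p. (- (p $ 2) / a\<^sup>2) *\<^sub>R axis 1 1) has_derivative
      (\<lambda>u. (- (u $ 2) / a\<^sup>2) *\<^sub>R axis 1 1 :: real ^ 2)) (at p)"
    by (intro has_derivative_scaleR_left bounded_linear.has_derivative[OF bounded_linear_divide]
        has_derivative_minus bounded_linear.has_derivative[OF bounded_linear_vec_nth] has_derivative_ident)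
  then have "(tension (total_metric a b) (base_metric a b) yz_projection has_derivative
      (\<lambda>u. (- (u $ 2) / a\<^sup>2) *\<^sub>R axis 1 1)) (at p)"
  proof (rule has_derivative_transform_within_open[OF _ open_upper_half_space])
    show "p \<in> upper_half_space" using y by (simp add: upper_half_space_def)
  qed (auto simp: upper_half_space_def tension_yz_projection[OF a] vec_eq_iff forall_2 axis_def)
  from frechet_derivative_at[OF this, symmetric] show ?thesis
    using a y
    by (simp add: pullback_connection_def pushforward_def christoffel_base tension_yz_projection
        vec_eq_iff forall_2 axis_def)
qed

section \<open>Proper biharmonicity\<close>

lemma bitension_yz_projection:
  assumes a: "a > 0" and y: "p $ 2 > 0"
  shows "bitension (total_metric a b) (base_metric a b) yz_projection p = 0"
proof -
  let ?\<tau> = "tension (total_metric a b) (base_metric a b) yz_projection"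
  have "(pullback_connection (base_metric a b) yz_projection Y ?\<tau> has_derivative (\<lambda>_. 0)) (at p)" for Y
    by (rule has_derivative_transform_within_open[OF has_derivative_const[of 0] open_upper_half_space])
      (use a y in \<open>auto simp: upper_half_space_def tension_parallel\<close>)
  from frechet_derivative_at[OF this, symmetric]
  have "second_covariant_derivative (total_metric a b) (base_metric a b) yz_projection X Y ?\<tau> p = 0"
    for X Y
    by (subst second_covariant_derivative_def, subst (1) pullback_connection_def)
      (use a y in \<open>simp add: tension_parallel christoffel_base vec_eq_iff forall_2\<close>)
  then show ?thesis
    using a y by (simp add: bitension_def metric_trace_def curvature_base)
qed

theorem proposition4p1:
  fixes a b :: real
  assumes "a > 0"
  shows "riemannian_submersion upper_half_space (total_metric a b)
           half_plane (base_metric a b) yz_projection \<and>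
         proper_biharmonic_map upper_half_space (total_metric a b)
           half_plane (base_metric a b) yz_projection"
proof -
  have "biharmonic_map upper_half_space (total_metric a b)
      half_plane (base_metric a b) yz_projection"
    using bitension_yz_projection[OF assms] smooth_riemannian_map_yz_projection[OF assms]
    by (simp add: biharmonic_map_def upper_half_space_def)
  moreover have "\<not> harmonic_map upper_half_space (total_metric a b)
      half_plane (base_metric a b) yz_projection"
  proof
    assume "harmonic_map upper_half_space (total_metric a b)
      half_plane (base_metric a b) yz_projection"
    then have "tension (total_metric a b) (base_metric a b) yz_projection (axis 2 1) $ 1 = 0"
      by (simp add: harmonic_map_def upper_half_space_def)
    then show False
      using assms by (simp add: tension_yz_projection)
  qed
  ultimately show ?thesis
    using riemannian_submersion_yz_projection[OF assms] by (simp add: proper_biharmonic_map_def)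
qed

end
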